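(* Let $k\ge 1$ and let $c_1,\dots,c_k$ be non-negative integers with $c_k>0$ and $\gcd\{m : c_m\neq 0\}=1$, and let $P(x)=x^k-c_1x^{k-1}-c_2x^{k-2}-\cdots-c_k$ be the characteristic polynomial of the recurrence $a_{n+1}=c_1a_n+\cdots+c_ka_{n+1-k}$ (a PLRR if $c_1>0$, a ZLRR if $c_1=0$). Let $r$ be the principal root of $P(x)$. Let $m\ge 1$ and let $\gamma_1,\gamma_2,\dots,\gamma_m$ be arbitrary real numbers, and for $t\le m$ set $$\Gamma_t(x)=\gamma_1x^{t-1}+\gamma_2x^{t-2}+\cdots+\gamma_{t-1}x+\gamma_t.$$ If $\Gamma_m(r)>0$, then there exists a polynomial $p(x)$ with real coefficients, divisible by $P(x)$ (in $\mathbb{R}[x]$), whose first (highest-degree) coefficients are $\gamma_1,\dots,\gamma_m$ and which has no positive coefficients thereafter; that is, there exist an integer $N\ge m$ and real numbers $\delta_{m+1},\dots,\delta_N\le 0$ such that $$p(x)=\sum_{i=1}^{m}\gamma_i x^{N-i}+\sum_{i=m+1}^{N}\delta_i x^{N-i}.$$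
   Context: A root of a polynomial is called principal if it is a positive root of multiplicity one whose magnitude is strictly greater than that of every other root. For $P(x)$ as in the claim (non-negative integer coefficients $c_i$, $c_k>0$, and the gcd of the indices of the nonzero $c_i$ equal to $1$), such a principal root exists and is unique. *)

theory Defs
  imports Complex_Main "HOL-Computational_Algebra.Computational_Algebra"
begin

text \<open>The coefficients of the recurrence are \<open>c 1, \<dots>, c k\<close>; other values of \<open>c\<close> play no role.\<close>

definition char_poly_rec :: "nat \<Rightarrow> (nat \<Rightarrow> nat) \<Rightarrow> real poly" where
  "char_poly_rec k c = monom 1 k - (\<Sum>i=1..k. monom (real (c i)) (k - i))"

text \<open>Multiplicity and positivity refer to the real root \<open>r\<close>; the other roots, over whose
  magnitudes \<open>r\<close> must dominate, range over all complex numbers.\<close>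

definition principal_root :: "real poly \<Rightarrow> real \<Rightarrow> bool" where
  "principal_root P r \<longleftrightarrow>
     r > 0 \<and> poly P r = 0 \<and> order r P = 1 \<and>
     (\<forall>z::complex. poly (map_poly complex_of_real P) z = 0 \<longrightarrow> z \<noteq> complex_of_real r \<longrightarrow>
        cmod z < r)"

definition Gamma_poly :: "(nat \<Rightarrow> real) \<Rightarrow> nat \<Rightarrow> real poly" where
  "Gamma_poly \<gamma> t = (\<Sum>i=1..t. monom (\<gamma> i) (t - i))"

end

theory Submission
  imports Defs
begin

text \<open>Write \<open>P = (x - r) Q\<close>. Comparing coefficients upwards from the constant term shows that \<open>Q\<close>
  has only positive coefficients below its degree bound, and \<open>x\<^sup>n Q\<close> leaves the remainder \<open>r\<^sup>n Q\<close>
  modulo \<open>P\<close>. The polynomial \<open>f = Q(r) \<Gamma> - \<Gamma>(r) Q\<close> vanishes at \<open>r\<close>, so the remainder of \<open>x\<^sup>n f\<close>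
  modulo \<open>P\<close> is governed by the roots of \<open>Q\<close>, all smaller than \<open>r\<close> in modulus, and is
  \<open>o(r\<^sup>n)\<close>. Hence the remainder of \<open>x\<^sup>n \<Gamma>\<close> is asymptotically a positive multiple of \<open>r\<^sup>n Q\<close>; for
  large \<open>n\<close> its coefficients are non-negative, and subtracting it from \<open>x\<^sup>n \<Gamma>\<close> gives \<open>p\<close>.\<close>

lemma tendsto_zero_contraction:
  fixes u e :: "nat \<Rightarrow> 'a::real_normed_field"
  assumes rec: "\<And>n. u (Suc n) = w * u n + e n" and w: "norm w < 1" and e: "e \<longlonglongrightarrow> 0"
  shows "u \<longlonglongrightarrow> 0"
proof (rule LIMSEQ_I)
  fix \<epsilon> :: real
  assume \<epsilon>: "0 < \<epsilon>"
  \<comment> \<open>This threshold makes \<open>\<epsilon> / 2\<close> the fixed point of t |-> |w|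
    t + threshold, so accumulated errors contribute at most \<open>\<epsilon> / 2\<close> in
    \<open>bound\<close>.\<close>
  have "\<epsilon> / 2 * (1 - norm w) > 0" using \<epsilon> w by simp
  from LIMSEQ_D[OF e this] obtain n0
    where n0: "\<And>n. n \<ge> n0 \<Longrightarrow> norm (e n) < \<epsilon> / 2 * (1 - norm w)" by auto
  have bound: "norm (u (n0 + j)) \<le> norm w ^ j * norm (u n0) + \<epsilon> / 2" for j
  proof (induction j)
    case 0
    then show ?case using \<epsilon> by simp
  next
    case (Suc j)
    have "norm (u (n0 + Suc j)) \<le> norm w * norm (u (n0 + j)) + norm (e (n0 + j))"
      using norm_triangle_ineq[of "w * u (n0 + j)" "e (n0 + j)"] by (simp add: rec norm_mult)
    also have "\<dots> \<le> norm w * (norm w ^ j * norm (u n0) + \<epsilon> / 2) + \<epsilon> / 2 * (1 - norm w)"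
      using Suc n0[of "n0 + j"] by (intro add_mono mult_left_mono) auto
    also have "\<dots> = norm w ^ Suc j * norm (u n0) + \<epsilon> / 2" by (simp add: field_simps)
    finally show ?case .
  qed
  have "(\<lambda>j. norm w ^ j * norm (u n0)) \<longlonglongrightarrow> 0"
    using tendsto_mult_right[OF LIMSEQ_power_zero[of "norm w"], of "norm (u n0)"] w by simp
  from LIMSEQ_D[OF this, of "\<epsilon> / 2"] \<epsilon> obtain j0
    where j0: "\<And>j. j \<ge> j0 \<Longrightarrow> norm w ^ j * norm (u n0) < \<epsilon> / 2" by auto
  have "norm (u n - 0) < \<epsilon>" if "n \<ge> n0 + j0" for n
  proof -
    have "n0 + (n - n0) = n" "j0 \<le> n - n0" using that by simp_all
    then show ?thesis using bound[of "n - n0"] j0[of "n - n0"] by simp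
  qed
  then show "\<exists>no. \<forall>n\<ge>no. norm (u n - 0) < \<epsilon>" by blast
qed

text \<open>Induction on the degree splits off one root z of \<open>Q\<close> at a time, so repeated
  roots need no separate treatment. Keeping \<open>L\<close> abstract lets the induction pass to h
  |-> L((x - z) h), which kills the multiples of Q / (x - z).\<close>

lemma linear_functional_decay:
  fixes L :: "complex poly \<Rightarrow> complex" and Q :: "complex poly" and r :: real
  assumes "r > 0" and "Q \<noteq> 0" and "\<And>z. poly Q z = 0 \<Longrightarrow> cmod z < r"
    and "\<And>p q. L (p + q) = L p + L q" and "\<And>a p. L (smult a p) = a * L p"
    and "\<And>h. L (Q * h) = 0"
  shows "(\<lambda>n. L (monom 1 n) / of_real r ^ n) \<longlonglongrightarrow> 0"
  using assms(2-)
proof (induction "degree Q" arbitrary: Q L)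
  case 0
  then obtain a where a: "Q = [:a:]" "a \<noteq> 0"
    by (metis degree_eq_zeroE pCons_0_0)
  \<comment> \<open>Every polynomial is a multiple of a nonzero constant.\<close>
  have "L p = 0" for p
    using "0.prems"(5)[of "smult (1 / a) p"] a by simp
  then show ?case by simp
next
  case (Suc d)
  have "\<not> constant (poly Q)" using Suc.hyps(2) by (simp add: constant_degree)
  then obtain z where z: "poly Q z = 0" using fundamental_theorem_of_algebra by blast
  then obtain Q' where Q': "Q = [:- z, 1:] * Q'" by (auto simp: poly_eq_0_iff_dvd)
  have "Q' \<noteq> 0" using Suc.prems(1) Q' by auto
  then have d: "d = degree Q'" using Suc.hyps(2) degree_mult_eq[of "[:- z, 1:]" Q'] Q' by simp
  define L' where "L' h = L ([:- z, 1:] * h)" for h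
  have dec: "(\<lambda>n. L' (monom 1 n) / of_real r ^ n) \<longlonglongrightarrow> 0"
  proof (rule Suc.hyps(1)[OF d \<open>Q' \<noteq> 0\<close>])
    show "cmod y < r" if "poly Q' y = 0" for y
      using Suc.prems(2)[of y] that Q' by simp
    show "L' (p + q) = L' p + L' q" for p q
      unfolding L'_def distrib_left by (rule Suc.prems(3))
    show "L' (smult a p) = a * L' p" for a p
      unfolding L'_def mult_smult_right by (rule Suc.prems(4))
    show "L' (Q' * h) = 0" for h
      using Suc.prems(5)[of h] unfolding L'_def Q' by (simp only: mult.assoc)
  qed
  \<comment> \<open>Since x^(n+1) = z x^n + (x - z) x^n, division by r^(n+1) gives a contraction
    with ratio z / r and an error that decays by induction.\<close>
  have step: "L (monom 1 (Suc n)) = z * L (monom 1 n) + L' (monom 1 n)" for n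
  proof -
    have "monom 1 (Suc n) = smult z (monom 1 n) + [:- z, 1:] * monom 1 n"
      by (simp add: monom_Suc)
    then show ?thesis unfolding L'_def using Suc.prems(3,4) by metis
  qed
  show ?case
  proof (rule tendsto_zero_contraction)
    show "L (monom 1 (Suc n)) / of_real r ^ Suc n
        = z / of_real r * (L (monom 1 n) / of_real r ^ n)
          + L' (monom 1 n) / of_real r ^ n / of_real r" for n
      using \<open>r > 0\<close> by (simp add: step field_simps)
    show "norm (z / of_real r) < 1"
      using Suc.prems(2)[OF z] \<open>r > 0\<close> by (simp add: norm_divide)
    show "(\<lambda>n. L' (monom 1 n) / of_real r ^ n / of_real r) \<longlonglongrightarrow> 0"
      using tendsto_divide_zero[OF dec] .
  qed
qed

lemma map_poly_of_real_mult:
  "map_poly complex_of_real (p * q) = map_poly complex_of_real p * map_poly complex_of_real q"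
  by (rule poly_eqI) (simp add: coeff_map_poly coeff_mult)

lemma poly_map_poly_of_real:
  "poly (map_poly complex_of_real p) (of_real x) = of_real (poly p x)"
  by (induction p) (simp_all add: map_poly_pCons)

text \<open>The embedding preserves degrees, so a real division with remainder is also one over the
  complex numbers.\<close>

lemma map_poly_of_real_mod:
  assumes "q \<noteq> 0"
  shows "map_poly complex_of_real (p mod q)
       = map_poly complex_of_real p mod map_poly complex_of_real q"
proof -
  let ?c = "map_poly complex_of_real"
  have add: "?c (a + b) = ?c a + ?c b" for a b
    by (rule poly_eqI) (simp add: coeff_map_poly)
  have "?c p = ?c (p mod q) + ?c (p div q) * ?c q"
    by (metis add map_poly_of_real_mult mod_div_mult_eq)
  then have "?c p mod ?c q = ?c (p mod q) mod ?c q" by simp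
  also have "\<dots> = ?c (p mod q)"
    using degree_mod_less[OF assms, of p]
    by (cases "p mod q = 0") (auto intro!: mod_poly_less simp: degree_map_poly)
  finally show ?thesis by simp
qed

text \<open>The factor x - r of \<open>f\<close> supplies what \<open>Q\<close> lacks: Q h f is a
  multiple of \<open>P\<close>. So h |-> coefficient \<open>j\<close> of h f mod P kills the
  multiples of \<open>Q\<close>, all of whose complex roots lie inside the circle of radius
  \<open>r\<close>.\<close>

lemma coeff_mod_decay:
  fixes P Q f :: "real poly" and r :: real
  assumes r: "r > 0" and P: "P = [:- r, 1:] * Q" "P \<noteq> 0" and f: "poly f r = 0"
    and roots: "\<And>z. poly (map_poly complex_of_real Q) z = 0 \<Longrightarrow> cmod z < r"
  shows "(\<lambda>n. coeff ((monom 1 n * f) mod P) j / r ^ n) \<longlonglongrightarrow> 0"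
proof -
  let ?c = "map_poly complex_of_real"
  define L where "L h = coeff ((h * ?c f) mod ?c P) j" for h
  obtain g where g: "f = [:- r, 1:] * g" using f by (auto simp: poly_eq_0_iff_dvd)
  have "(\<lambda>n. L (monom 1 n) / of_real r ^ n) \<longlonglongrightarrow> 0"
  proof (rule linear_functional_decay[OF r _ roots])
    show "?c Q \<noteq> 0" using P by (auto simp: map_poly_eq_0_iff)
    show "L (p + q) = L p + L q" for p q
      by (simp add: L_def distrib_right poly_mod_add_left)
    show "L (smult a p) = a * L p" for a p
      by (simp add: L_def mod_smult_left)
    have "?c Q * h * ?c f = ?c P * (h * ?c g)" for h
      unfolding P g map_poly_of_real_mult by (simp only: mult_ac)
    then show "L (?c Q * h) = 0" for h by (simp only: L_def mod_mult_self1_is_0 coeff_0)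
  qed
  moreover have "L (monom 1 n) = of_real (coeff ((monom 1 n * f) mod P) j)" for n
  proof -
    have "monom 1 n * ?c f = ?c (monom 1 n * f)"
      by (simp add: map_poly_of_real_mult map_poly_monom)
    then show ?thesis
      by (simp add: L_def map_poly_of_real_mod[OF P(2), symmetric] coeff_map_poly)
  qed
  ultimately have "(\<lambda>n. complex_of_real (coeff ((monom 1 n * f) mod P) j / r ^ n)) \<longlonglongrightarrow> of_real 0"
    by simp
  then show ?thesis by (simp only: tendsto_of_real_iff)
qed

lemma coeff_char_poly_rec:
  "coeff (char_poly_rec k c) j
     = (if j = k then 1 else 0) - (if j < k then real (c (k - j)) else 0)"
proof -
  have "(\<Sum>i=1..k. if k - i = j then real (c i) else 0)
      = (\<Sum>i=1..k. if i = k - j then (if j < k then real (c (k - j)) else 0) else 0)"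
    by (intro sum.cong) auto
  also have "\<dots> = (if j < k then real (c (k - j)) else 0)"
    by (subst sum.delta) auto
  finally show ?thesis
    by (simp add: char_poly_rec_def coeff_sum)
qed

lemma degree_char_poly_rec: "degree (char_poly_rec k c) = k"
proof (rule antisym)
  show "degree (char_poly_rec k c) \<le> k"
    by (rule degree_le) (simp add: coeff_char_poly_rec)
  show "k \<le> degree (char_poly_rec k c)"
    by (rule le_degree) (simp add: coeff_char_poly_rec)
qed

lemma cofactor_coeff_pos:
  assumes r: "r > 0" and ck: "c k > 0" and k: "k \<ge> 1"
    and Q: "char_poly_rec k c = [:- r, 1:] * Q" and "j < k"
  shows "coeff Q j > 0"
  using \<open>j < k\<close>
proof (induction j)
  case 0
  have "coeff (char_poly_rec k c) 0 = - (r * coeff Q 0)" unfolding Q by simp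
  then have "r * coeff Q 0 > 0" using ck k by (simp add: coeff_char_poly_rec)
  then show ?case using r by (simp add: zero_less_mult_iff)
next
  case (Suc j)
  \<comment> \<open>As \<open>Suc j < k\<close>, the left side is minus some c_i, so r q_(j+1) = q_j
    + c_i >= q_j > 0.\<close>
  have "coeff (char_poly_rec k c) (Suc j) = coeff Q j - r * coeff Q (Suc j)"
    unfolding Q by simp
  then have "r * coeff Q (Suc j) > 0" using Suc by (simp add: coeff_char_poly_rec)
  then show ?case using r by (simp add: zero_less_mult_iff)
qed

lemma mod_eventually_nonneg:
  fixes G :: "real poly"
  assumes k: "k \<ge> 1" and ck: "c k > 0" and pr: "principal_root (char_poly_rec k c) r"
    and G: "poly G r > 0"
  shows "eventually (\<lambda>n. \<forall>j. coeff ((monom 1 n * G) mod char_poly_rec k c) j \<ge> 0) sequentially"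
proof -
  define P where "P = char_poly_rec k c"
  have r: "r > 0" and root: "poly P r = 0"
    and dom: "\<And>z. poly (map_poly complex_of_real P) z = 0 \<Longrightarrow> z \<noteq> of_real r \<Longrightarrow> cmod z < r"
    using pr by (auto simp: principal_root_def P_def)
  have degP: "degree P = k" by (simp add: P_def degree_char_poly_rec)
  have P0: "P \<noteq> 0" using degP k by auto
  obtain Q where Q: "P = [:- r, 1:] * Q" using root by (auto simp: poly_eq_0_iff_dvd)
  have Q0: "Q \<noteq> 0" using Q P0 by auto
  have degQ: "degree Q < k"
    using degP degree_mult_eq[of "[:- r, 1:]" Q] Q0 unfolding Q by simp
  have qpos: "coeff Q j > 0" if "j < k" for j
    using cofactor_coeff_pos[OF r ck k Q[unfolded P_def] that] .
  have Qr: "poly Q r > 0"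
    unfolding poly_altdef using qpos degQ r by (intro sum_pos) auto
  define f where "f = smult (poly Q r) G - smult (poly G r) Q"
  \<comment> \<open>Roots of \<open>Q\<close> are roots of \<open>P\<close>, and Q(r) > 0 excludes
    \<open>r\<close> itself.\<close>
  have roots: "cmod z < r" if z: "poly (map_poly complex_of_real Q) z = 0" for z
  proof (rule dom)
    show "poly (map_poly complex_of_real P) z = 0"
      unfolding Q map_poly_of_real_mult using z by simp
    show "z \<noteq> of_real r" using z Qr poly_map_poly_of_real[of Q r] by auto
  qed
  \<comment> \<open>x - r divides x^n - r^n, so (x^n - r^n) Q is a multiple of \<open>P\<close>, and
    r^n Q is already reduced.\<close>
  have modQ: "(monom 1 n * Q) mod P = smult (r ^ n) Q" for n
  proof -
    have "poly (monom 1 n - [:r ^ n:]) r = 0" by (simp add: poly_monom)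
    then obtain h where h: "monom 1 n - [:r ^ n:] = [:- r, 1:] * h"
      unfolding poly_eq_0_iff_dvd by (rule dvdE)
    have "monom 1 n * Q - smult (r ^ n) Q = (monom 1 n - [:r ^ n:]) * Q"
      by (simp add: left_diff_distrib)
    also have "\<dots> = P * h" unfolding h Q by (simp only: mult_ac)
    finally have "monom 1 n * Q - smult (r ^ n) Q = P * h" .
    then have "monom 1 n * Q = smult (r ^ n) Q + P * h" by (simp add: algebra_simps)
    then have "(monom 1 n * Q) mod P = smult (r ^ n) Q mod P" by simp
    also have "\<dots> = smult (r ^ n) Q"
      using degQ degP by (intro mod_poly_less) simp
    finally show ?thesis .
  qed
  have split: "poly Q r * coeff ((monom 1 n * G) mod P) j
      = coeff ((monom 1 n * f) mod P) j + poly G r * r ^ n * coeff Q j" for n j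
  proof -
    have "smult (poly Q r) (monom 1 n * G) = monom 1 n * f + smult (poly G r) (monom 1 n * Q)"
      by (simp add: f_def algebra_simps)
    then have "smult (poly Q r) (monom 1 n * G) mod P
        = (monom 1 n * f) mod P + smult (poly G r) (smult (r ^ n) Q)"
      by (simp only: poly_mod_add_left mod_smult_left modQ)
    from arg_cong[OF this, of "\<lambda>p. coeff p j"] show ?thesis
      by (simp add: mod_smult_left)
  qed
  have "eventually (\<lambda>n. coeff ((monom 1 n * G) mod P) j \<ge> 0) sequentially" if j: "j < k" for j
  proof -
    have "(\<lambda>n. coeff ((monom 1 n * f) mod P) j / r ^ n) \<longlonglongrightarrow> 0"
      by (rule coeff_mod_decay[OF r Q P0 _ roots]) (simp add: f_def)
    \<comment> \<open>After division by r^n, the right side of \<open>split\<close> tends to G(r)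
      q_j > 0; its first term need only exceed the negative of that limit.\<close>
    moreover have "- (poly G r * coeff Q j) < 0" using G qpos[OF j] by simp
    ultimately have "eventually (\<lambda>n. - (poly G r * coeff Q j)
        < coeff ((monom 1 n * f) mod P) j / r ^ n) sequentially"
      by (rule order_tendstoD(1))
    then show ?thesis
    proof eventually_elim
      case (elim n)
      then have "poly Q r * coeff ((monom 1 n * G) mod P) j > 0"
        unfolding split using r by (simp add: field_simps)
      then show ?case using Qr by (simp add: zero_less_mult_iff)
    qed
  qed
  then have "eventually (\<lambda>n. \<forall>j\<in>{..<k}. coeff ((monom 1 n * G) mod P) j \<ge> 0) sequentially"
    by (intro eventually_ball_finite) auto
  then show ?thesis
  proof eventually_elim
    case (elim n)
    \<comment> \<open>Coefficients from \<open>k\<close> upwards vanish, so finitely many eventual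
      inequalities suffice.\<close>
    have "coeff ((monom 1 n * G) mod P) j = 0" if "\<not> j < k" for j
      using degree_mod_less'[OF P0, of "monom 1 n * G"] degP that
      by (metis coeff_0 coeff_eq_0 leI less_le_trans)
    then show ?case using elim unfolding P_def by (metis lessThan_iff order_refl)
  qed
qed

theorem theorem1p8:
  fixes k m :: nat and c :: "nat \<Rightarrow> nat" and \<gamma> :: "nat \<Rightarrow> real" and r :: real
  assumes "k \<ge> 1"
    and "c k > 0"
    and "Gcd {j. 1 \<le> j \<and> j \<le> k \<and> c j \<noteq> 0} = 1"
    and "principal_root (char_poly_rec k c) r"
    and "m \<ge> 1"
    and "poly (Gamma_poly \<gamma> m) r > 0"
  shows "\<exists>(p :: real poly) (N :: nat) (\<delta> :: nat \<Rightarrow> real).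
           char_poly_rec k c dvd p \<and> N \<ge> m \<and>
           (\<forall>i\<in>{m+1..N}. \<delta> i \<le> 0) \<and>
           p = (\<Sum>i=1..m. monom (\<gamma> i) (N - i)) + (\<Sum>i=m+1..N. monom (\<delta> i) (N - i))"
proof -
  let ?P = "char_poly_rec k c"
  \<comment> \<open>The remainder has degree below \<open>k\<close>; with \<open>n \<ge> k\<close>
    it stays below x^n and cannot disturb the coefficients \<gamma>_i, which occupy degrees n to n +
    m - 1.\<close>
  have "eventually (\<lambda>n. n \<ge> k
      \<and> (\<forall>j. coeff ((monom 1 n * Gamma_poly \<gamma> m) mod ?P) j \<ge> 0)) sequentially"
    by (intro eventually_conj eventually_ge_at_top mod_eventually_nonneg[of k c r] assms)
  then obtain n where n: "n \<ge> k"
    and nonneg: "\<And>j. coeff ((monom 1 n * Gamma_poly \<gamma> m) mod ?P) j \<ge> 0"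
    by (auto simp: eventually_sequentially)
  define D where "D = (monom 1 n * Gamma_poly \<gamma> m) mod ?P"
  define N where "N = n + m"
  have "?P \<noteq> 0" using degree_char_poly_rec[of k c] assms(1) by auto
  then have "D = 0 \<or> degree D < k"
    using degree_mod_less[of ?P] degree_char_poly_rec[of k c] by (auto simp: D_def)
  then have D0: "coeff D j = 0" if "j \<ge> n" for j
    using n that by (auto intro: coeff_eq_0)
  have head: "(\<Sum>i=1..m. monom (\<gamma> i) (N - i)) = monom 1 n * Gamma_poly \<gamma> m"
    unfolding Gamma_poly_def sum_distrib_left
    by (intro sum.cong) (auto simp: mult_monom N_def)
  \<comment> \<open>The indices i = m+1..N correspond to the exponents N - i = n-1..0, which cover
    all of \<open>D\<close>.\<close>
  have "(\<Sum>i=m+1..N. monom (- coeff D (N - i)) (N - i)) = (\<Sum>j<n. monom (- coeff D j) j)"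
    by (rule sum.reindex_bij_witness[of _ "\<lambda>j. N - j" "\<lambda>i. N - i"]) (auto simp: N_def)
  also have "\<dots> = - D"
    by (rule poly_eqI) (auto simp: coeff_sum D0)
  finally have tail: "(\<Sum>i=m+1..N. monom (- coeff D (N - i)) (N - i)) = - D" .
  have "?P dvd monom 1 n * Gamma_poly \<gamma> m - D"
    unfolding D_def by (rule dvd_minus_mod)
  then show ?thesis
    using nonneg unfolding D_def[symmetric]
    by (intro exI[of _ "monom 1 n * Gamma_poly \<gamma> m - D"] exI[of _ N]
        exI[of _ "\<lambda>i. - coeff D (N - i)"]) (auto simp only: head tail, auto simp: N_def)
qed

end
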